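(* Let $G=(V,E)$ be an undirected connected multi-graph, $S\subseteq V$ a Steiner set, and $\lambda_S$ the capacity of an $S$-mincut. Let $C_1,C_2,C_3$ be three Steiner cuts of capacity $\lambda_S+1$. Define $V_a=C_1\cap\overline{C_2}\cap\overline{C_3}$, $V_b=\overline{C_1}\cap C_2\cap\overline{C_3}$, $V_c=\overline{C_1}\cap\overline{C_2}\cap C_3$, $V_{ab}=C_1\cap C_2\cap\overline{C_3}$, $V_{bc}=\overline{C_1}\cap C_2\cap C_3$, $V_{ac}=C_1\cap\overline{C_2}\cap C_3$, $V_{abc}=C_1\cap C_2\cap C_3$, $V_{\Phi}=\overline{C_1\cup C_2\cup C_3}$ (with $V_{ba}=V_{ab}$, $V_{cb}=V_{bc}$, $V_{ca}=V_{ac}$). Suppose there are Steiner vertices $a,b,c\in S$ with $a\in V_a$, $b\in V_b$, $c\in V_c$. Then: (1) $c(C_1\cap C_2\cap C_3)\le 3$. (2) For any $(\lambda_S+1)$-connectivity class $\mathcal{W}$ and any integer $k\in[0,3]$, if (i) there is a vertex $u\in V_{\Phi}\cap\mathcal{W}$ and (ii) exactly $k$ of the three sets $V_a,V_b,V_c$ contain a vertex of $\mathcal{W}$, then $c(C_1\cap C_2\cap C_3)\le 3-k$. (3) Let $x,y,z\in\{a,b,c\}$ be pairwise distinct. Vertices of $V_{xy}$ are adjacent to vertices of $V_{xy}$, $V_x$ and $V_y$; moreover, there are at most two edges between $V_{xy}$ and $V\setminus(V_x\cup V_y\cup V_{xy})=V_z\cup V_{xz}\cup V_{yz}\cup V_{xyz}\cup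 V_{\Phi}$.
   Context: For $X\subseteq V$, $\overline{X}=V\setminus X$ and $c(X)$ is the number of edges (with multiplicity) with exactly one endpoint in $X$ (so $c(\emptyset)=0$). A Steiner cut is a set $C\subset V$ with some vertex of $S$ in $C$ and some vertex of $S$ outside $C$; an $S$-mincut is a Steiner cut of minimum capacity $\lambda_S$. Two vertices $u,v$ are related iff no $S$-mincut separates them (i.e. contains exactly one of them); the equivalence classes of this relation are the $(\lambda_S+1)$-connectivity classes.
   Formalization: In (3), the clause that vertices of V_xy are adjacent to vertices of V_xy, V_x and V_y is false if read without exception; it is proved in the form that, apart from at most two edges, every neighbour of a vertex of V_xy lies in V_xy, V_x or V_y. *)

theory Defs
  imports Main "HOL-Library.Multiset" "HOL-Library.Uprod"
begin

text \<open>
  A multigraph is a finite vertex set with a multiset of unordered pairs of vertices, so parallel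
  edges are counted with multiplicity. Loops (\<open>Upair v v\<close>) are permitted; they never cross a cut.
\<close>

definition multigraph :: "'v set \<Rightarrow> 'v uprod multiset \<Rightarrow> bool" where
  "multigraph V E \<longleftrightarrow> finite V \<and> (\<forall>e\<in>#E. set_uprod e \<subseteq> V)"

definition adjacent :: "'v uprod multiset \<Rightarrow> 'v \<Rightarrow> 'v \<Rightarrow> bool" where
  "adjacent E u v \<longleftrightarrow> Upair u v \<in># E"

definition connected_multigraph :: "'v set \<Rightarrow> 'v uprod multiset \<Rightarrow> bool" where
  "connected_multigraph V E \<longleftrightarrow>
     multigraph V E \<and> V \<noteq> {} \<and> (\<forall>u\<in>V. \<forall>v\<in>V. (adjacent E)\<^sup>*\<^sup>* u v)"

definition edges_between :: "'v uprod multiset \<Rightarrow> 'v set \<Rightarrow> 'v set \<Rightarrow> 'v uprod multiset" where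
  "edges_between E A B = {#e \<in># E. \<exists>u\<in>A. \<exists>v\<in>B. e = Upair u v#}"

definition cut_capacity :: "'v uprod multiset \<Rightarrow> 'v set \<Rightarrow> nat" where
  "cut_capacity E X = size {#e \<in># E. \<exists>u v. e = Upair u v \<and> u \<in> X \<and> v \<notin> X#}"

definition steiner_cut :: "'v set \<Rightarrow> 'v set \<Rightarrow> 'v set \<Rightarrow> bool" where
  "steiner_cut V S C \<longleftrightarrow> C \<subseteq> V \<and> (\<exists>s\<in>S. s \<in> C) \<and> (\<exists>s\<in>S. s \<notin> C)"

text \<open>Only meaningful when some Steiner cut exists, i.e. when \<open>S\<close> has at least two vertices.\<close>

definition steiner_mincut_capacity :: "'v set \<Rightarrow> 'v uprod multiset \<Rightarrow> 'v set \<Rightarrow> nat" where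
  "steiner_mincut_capacity V E S = Min (cut_capacity E ` {C. steiner_cut V S C})"

definition steiner_mincut :: "'v set \<Rightarrow> 'v uprod multiset \<Rightarrow> 'v set \<Rightarrow> 'v set \<Rightarrow> bool" where
  "steiner_mincut V E S C \<longleftrightarrow>
     steiner_cut V S C \<and> cut_capacity E C = steiner_mincut_capacity V E S"

definition separates :: "'v set \<Rightarrow> 'v \<Rightarrow> 'v \<Rightarrow> bool" where
  "separates C u v \<longleftrightarrow> (u \<in> C) \<noteq> (v \<in> C)"

definition connectivity_rel :: "'v set \<Rightarrow> 'v uprod multiset \<Rightarrow> 'v set \<Rightarrow> 'v rel" where
  "connectivity_rel V E S =
     {(u, v). u \<in> V \<and> v \<in> V \<and> \<not> (\<exists>C. steiner_mincut V E S C \<and> separates C u v)}"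

definition connectivity_classes :: "'v set \<Rightarrow> 'v uprod multiset \<Rightarrow> 'v set \<Rightarrow> 'v set set" where
  "connectivity_classes V E S = V // connectivity_rel V E S"

lemma equiv_connectivity_rel: "equiv V (connectivity_rel V E S)"
  by (rule equivI)
    (auto simp: connectivity_rel_def separates_def refl_on_def sym_def trans_def)

end

theory Submission
  imports Defs
begin

text \<open>
  Colour a vertex by the set of those \<open>i\<close> with the vertex in \<open>Ci\<close>. The capacities of the three cuts
  count every edge with the Hamming distance of the colours of its ends, whereas the capacities of
  \<open>Va\<close>, \<open>Vb\<close>, \<open>Vc\<close>, \<open>Vabc\<close> together count the ends of odd colour of every edge with ends of
  distinct colours; the latter number is never larger. As \<open>Va\<close>, \<open>Vb\<close>, \<open>Vc\<close> are Steiner cuts, only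
  \<open>3\<close> is left for \<open>Vabc\<close>, and one less for each of them that separates two vertices of one
  connectivity class, as it is then not a minimum cut. For the last part, posimodularity is applied
  to \<open>(C1, C3)\<close>, to \<open>(C2, C3)\<close> and then to the resulting pair \<open>(C1 - C3, C2 - C3)\<close>, where the edges
  leaving \<open>Vab\<close> past \<open>Va\<close> and \<open>Vb\<close> appear twice in a total slack of \<open>4\<close>.
\<close>

lemma cut_capacity_empty [simp]: "cut_capacity {#} X = 0"
  by (simp add: cut_capacity_def)

lemma cut_capacity_add_Upair [simp]:
  "cut_capacity (add_mset (Upair x y) E) X
     = cut_capacity E X + (if (x \<in> X) = (y \<in> X) then 0 else 1)"
proof -
  have "(\<exists>u v. Upair x y = Upair u v \<and> u \<in> X \<and> v \<notin> X) \<longleftrightarrow> (x \<in> X) \<noteq> (y \<in> X)"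
    by auto
  then show ?thesis
    unfolding cut_capacity_def by simp
qed

lemma size_edges_between_empty [simp]: "size (edges_between {#} A B) = 0"
  by (simp add: edges_between_def)

lemma size_edges_between_add_Upair [simp]:
  "size (edges_between (add_mset (Upair x y) E) A B)
     = size (edges_between E A B) + (if x \<in> A \<and> y \<in> B \<or> y \<in> A \<and> x \<in> B then 1 else 0)"
proof -
  have "(\<exists>u\<in>A. \<exists>v\<in>B. Upair x y = Upair u v) \<longleftrightarrow> x \<in> A \<and> y \<in> B \<or> y \<in> A \<and> x \<in> B"
    by auto
  then show ?thesis
    unfolding edges_between_def by simp
qed

text \<open>Contributions compare edge by edge: an edge from \<open>X \<inter> Y\<close> to
  \<open>D\<close> crosses both \<open>X\<close> and \<open>Y\<close> but neither difference, which
  pays for the factor 2. With \<open>D = {}\<close> this gives ordinary posimodularity.\<close>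

lemma cut_capacity_posimodular:
  assumes "D \<inter> (X \<union> Y) = {}"
  shows "cut_capacity E (X - Y) + cut_capacity E (Y - X) + 2 * size (edges_between E (X \<inter> Y) D)
    \<le> cut_capacity E X + cut_capacity E Y"
proof (induction E)
  case empty
  show ?case by simp
next
  case (add e E)
  obtain x y where "e = Upair x y" by (cases e)
  moreover have "x \<in> D \<Longrightarrow> x \<notin> X \<and> x \<notin> Y" "y \<in> D \<Longrightarrow> y \<notin> X \<and> y \<notin> Y"
    using assms by auto
  ultimately show ?case
    using add by (cases "x \<in> X"; cases "x \<in> Y"; cases "y \<in> X"; cases "y \<in> Y") auto
qed

text \<open>The critical edges join two distinct odd colours and count 2 on the left. Colours of
  equal parity that differ do so in at least two of the three sets, so the right side counts at
  least 2 as well.\<close>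

lemma cut_capacity_three_cuts:
  "cut_capacity E (X - Y - Z) + cut_capacity E (Y - X - Z) + cut_capacity E (Z - X - Y)
     + cut_capacity E (X \<inter> Y \<inter> Z)
   \<le> cut_capacity E X + cut_capacity E Y + cut_capacity E Z"
proof (induction E)
  case empty
  show ?case by simp
next
  case (add e E)
  obtain x y where "e = Upair x y" by (cases e)
  then show ?case
    using add
    by (cases "x \<in> X"; cases "x \<in> Y"; cases "x \<in> Z"; cases "y \<in> X"; cases "y \<in> Y"; cases "y \<in> Z")
      simp_all
qed

lemma steiner_mincut_capacity_le:
  assumes "finite V" "steiner_cut V S C"
  shows "steiner_mincut_capacity V E S \<le> cut_capacity E C"
proof -
  have "finite {C. steiner_cut V S C}"
    by (rule finite_subset[of _ "Pow V"]) (use assms in \<open>auto simp: steiner_cut_def\<close>)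
  then show ?thesis
    unfolding steiner_mincut_capacity_def using assms by (intro Min_le) auto
qed

text \<open>A Steiner cut that splits a class is not minimum, and capacities are integers.\<close>

lemma connectivity_class_separated:
  assumes "finite V" "steiner_cut V S C" "W \<in> connectivity_classes V E S"
    and "u \<in> W" "v \<in> W" "u \<in> C" "v \<notin> C"
  shows "steiner_mincut_capacity V E S + 1 \<le> cut_capacity E C"
proof -
  have "(u, v) \<in> connectivity_rel V E S"
    using quotient_eq_iff[OF equiv_connectivity_rel, of W V E S W u v] assms(3-5)
    by (simp add: connectivity_classes_def)
  then have "\<not> steiner_mincut V E S C"
    using assms(6,7) by (auto simp: connectivity_rel_def separates_def)
  then show ?thesis
    using steiner_mincut_capacity_le[OF assms(1,2), of E] assms(2)
    by (simp add: steiner_mincut_def)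
qed

text \<open>The vertex \<open>c\<close> makes \<open>Z - X\<close> and \<open>Z - Y\<close> Steiner
  cuts, so posimodularity bounds the capacities of \<open>X - Z\<close> and \<open>Y - Z\<close> by
  the minimum plus 2. The regions enter through equations so that the rule applies to named
  sets.\<close>

lemma edges_leaving_pairwise_intersection:
  assumes "multigraph V E" "X \<subseteq> V" "Y \<subseteq> V" "Z \<subseteq> V"
    and "cut_capacity E X \<le> steiner_mincut_capacity V E S + 1"
    and "cut_capacity E Y \<le> steiner_mincut_capacity V E S + 1"
    and "cut_capacity E Z \<le> steiner_mincut_capacity V E S + 1"
    and "a \<in> S" "a \<in> X - Y - Z" "b \<in> S" "b \<in> Y - X - Z" "c \<in> S" "c \<in> Z - X - Y"
    and "Vx = X - Y - Z" "Vy = Y - X - Z" "Vxy = X \<inter> Y - Z"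
  shows "size (edges_between E Vxy (V - (Vx \<union> Vy \<union> Vxy))) \<le> 2"
proof -
  have le: "steiner_mincut_capacity V E S \<le> cut_capacity E C" if "steiner_cut V S C" for C
    using steiner_mincut_capacity_le that assms(1) by (auto simp: multigraph_def)
  let ?D = "V - ((X - Y - Z) \<union> (Y - X - Z) \<union> (X \<inter> Y - Z))"
  \<comment> \<open>The union of \<open>X - Z\<close> and \<open>Y - Z\<close> is exactly the three
    regions removed in \<open>?D\<close>, hence the disjointness.\<close>
  have sets: "(X - Z) - (Y - Z) = X - Y - Z" "(Y - Z) - (X - Z) = Y - X - Z"
    "(X - Z) \<inter> (Y - Z) = X \<inter> Y - Z" "?D \<inter> ((X - Z) \<union> (Y - Z)) = {}"
    by auto
  have "cut_capacity E (X - Y - Z) + cut_capacity E (Y - X - Z)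
      + 2 * size (edges_between E (X \<inter> Y - Z) ?D)
    \<le> cut_capacity E (X - Z) + cut_capacity E (Y - Z)"
    using cut_capacity_posimodular[OF sets(4), of E] by (simp only: sets)
  moreover have "cut_capacity E (X - Z) + cut_capacity E (Z - X) \<le> cut_capacity E X + cut_capacity E Z"
    "cut_capacity E (Y - Z) + cut_capacity E (Z - Y) \<le> cut_capacity E Y + cut_capacity E Z"
    using cut_capacity_posimodular[of "{}" X Z E] cut_capacity_posimodular[of "{}" Y Z E] by auto
  moreover have "steiner_cut V S (X - Y - Z)" "steiner_cut V S (Y - X - Z)"
    "steiner_cut V S (Z - X)" "steiner_cut V S (Z - Y)"
    using assms(2-4,8-13) unfolding steiner_cut_def by blast+
  then have "steiner_mincut_capacity V E S \<le> cut_capacity E (X - Y - Z)"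
    "steiner_mincut_capacity V E S \<le> cut_capacity E (Y - X - Z)"
    "steiner_mincut_capacity V E S \<le> cut_capacity E (Z - X)"
    "steiner_mincut_capacity V E S \<le> cut_capacity E (Z - Y)"
    by (simp_all add: le)
  \<comment> \<open>In the sum \<open>Z\<close> counts twice: twice the number of edges is at most
    four times the minimum plus 4, less the four lower bounds.\<close>
  ultimately have "size (edges_between E (X \<inter> Y - Z) ?D) \<le> 2"
    using assms(5-7) by linarith
  then show ?thesis
    by (simp only: assms(14-16))
qed

lemma adjacent_after_removing_edges_between:
  assumes "multigraph V E" "u \<in> A" "adjacent (E - edges_between E A (V - B)) u v"
  shows "v \<in> B"
proof -
  \<comment> \<open>The subtraction removes all parallel copies of an offending edge, so no such
    edge survives.\<close>
  have "E - edges_between E A (V - B) = {#e \<in># E. \<not> (\<exists>u\<in>A. \<exists>v\<in>V - B. e = Upair u v)#}"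
    unfolding edges_between_def by (rule multiset_eqI) simp
  then have "Upair u v \<in># E" "v \<notin> V - B"
    using assms(2,3) by (auto simp: adjacent_def)
  then show ?thesis
    using assms(1) by (fastforce simp: multigraph_def)
qed

theorem theorem36:
  fixes V S C1 C2 C3 :: "'v set" and E :: "'v uprod multiset"
    and Va Vb Vc Vab Vbc Vac Vabc VPhi :: "'v set"
    and a b c :: 'v
  assumes "connected_multigraph V E" and "S \<subseteq> V"
    and "steiner_cut V S C1" and "cut_capacity E C1 = steiner_mincut_capacity V E S + 1"
    and "steiner_cut V S C2" and "cut_capacity E C2 = steiner_mincut_capacity V E S + 1"
    and "steiner_cut V S C3" and "cut_capacity E C3 = steiner_mincut_capacity V E S + 1"
    and "Va = C1 \<inter> (V - C2) \<inter> (V - C3)"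
    and "Vb = (V - C1) \<inter> C2 \<inter> (V - C3)"
    and "Vc = (V - C1) \<inter> (V - C2) \<inter> C3"
    and "Vab = C1 \<inter> C2 \<inter> (V - C3)"
    and "Vbc = (V - C1) \<inter> C2 \<inter> C3"
    and "Vac = C1 \<inter> (V - C2) \<inter> C3"
    and "Vabc = C1 \<inter> C2 \<inter> C3"
    and "VPhi = V - (C1 \<union> C2 \<union> C3)"
    and "a \<in> S" and "a \<in> Va"
    and "b \<in> S" and "b \<in> Vb"
    and "c \<in> S" and "c \<in> Vc"
  shows "cut_capacity E (C1 \<inter> C2 \<inter> C3) \<le> 3
    \<and> (\<forall>W \<in> connectivity_classes V E S. \<forall>k \<in> {0..3::int}.
         (\<exists>u. u \<in> VPhi \<inter> W) \<and> int (card {X \<in> {Va, Vb, Vc}. \<exists>w. w \<in> X \<inter> W}) = k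
         \<longrightarrow> int (cut_capacity E (C1 \<inter> C2 \<inter> C3)) \<le> 3 - k)
    \<and> (\<forall>(Vx, Vy, Vz, Vxy, Vyz, Vxz) \<in>
         {(Va, Vb, Vc, Vab, Vbc, Vac), (Va, Vc, Vb, Vac, Vbc, Vab),
          (Vb, Va, Vc, Vab, Vac, Vbc), (Vb, Vc, Va, Vbc, Vac, Vab),
          (Vc, Va, Vb, Vac, Vab, Vbc), (Vc, Vb, Va, Vbc, Vab, Vac)}.
         (\<exists>F. F \<subseteq># E \<and> size F \<le> 2
            \<and> (\<forall>u \<in> Vxy. \<forall>v. adjacent (E - F) u v \<longrightarrow> v \<in> Vxy \<union> Vx \<union> Vy))
         \<and> V - (Vx \<union> Vy \<union> Vxy) = Vz \<union> Vxz \<union> Vyz \<union> Vabc \<union> VPhi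
         \<and> size (edges_between E Vxy (V - (Vx \<union> Vy \<union> Vxy))) \<le> 2)"
proof (intro conjI ballI impI)
  let ?l = "steiner_mincut_capacity V E S"
  have mg: "multigraph V E" and fin: "finite V"
    using assms(1) by (auto simp: connected_multigraph_def multigraph_def)
  have sub: "C1 \<subseteq> V" "C2 \<subseteq> V" "C3 \<subseteq> V"
    using assms(3,5,7) by (auto simp: steiner_cut_def)
  have Va: "Va = C1 - C2 - C3" and Vb: "Vb = C2 - C1 - C3" and Vc: "Vc = C3 - C1 - C2"
    and Vab: "Vab = C1 \<inter> C2 - C3" and Vbc: "Vbc = C2 \<inter> C3 - C1" and Vac: "Vac = C1 \<inter> C3 - C2"
    using sub assms(9-14) by auto
  have abc: "a \<in> C1 - C2 - C3" "b \<in> C2 - C1 - C3" "c \<in> C3 - C1 - C2"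
    using assms(18,20,22) Va Vb Vc by auto
  have st: "steiner_cut V S Va" "steiner_cut V S Vb" "steiner_cut V S Vc"
    using sub abc assms(17,19,21) unfolding steiner_cut_def Va Vb Vc by blast+
  have slack: "cut_capacity E Va + cut_capacity E Vb + cut_capacity E Vc
      + cut_capacity E (C1 \<inter> C2 \<inter> C3) \<le> 3 * ?l + 3"
    using cut_capacity_three_cuts[of E C1 C2 C3] assms(4,6,8) unfolding Va Vb Vc by simp
  note le = st[THEN steiner_mincut_capacity_le[OF fin, of S _ E]]
  show "cut_capacity E (C1 \<inter> C2 \<inter> C3) \<le> 3"
    using slack le by linarith
  show "int (cut_capacity E (C1 \<inter> C2 \<inter> C3)) \<le> 3 - k"
    if W: "W \<in> connectivity_classes V E S"
      and k: "(\<exists>u. u \<in> VPhi \<inter> W) \<and> int (card {X \<in> {Va, Vb, Vc}. \<exists>w. w \<in> X \<inter> W}) = k" for W k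
  proof -
    \<comment> \<open>A single vertex of \<open>VPhi\<close> serves as the outer end for all three
      sets.\<close>
    obtain u where u: "u \<in> W" "u \<notin> Va" "u \<notin> Vb" "u \<notin> Vc"
      using k assms(16) Va Vb Vc by auto
    let ?n = "\<lambda>X. if \<exists>w. w \<in> X \<inter> W then 1 else 0 :: nat"
    \<comment> \<open>The indicator \<open>?n\<close> merges the plain minimum bound with the
      improved bound for sets that meet \<open>W\<close>.\<close>
    have gt: "?l + ?n X \<le> cut_capacity E X" if "steiner_cut V S X" "u \<notin> X" for X
      using steiner_mincut_capacity_le[OF fin that(1), of E]
        connectivity_class_separated[OF fin that(1) W _ u(1) _ that(2)] by auto
    \<comment> \<open>Distinctness ensures that the sum over the set really has three terms.\<close>
    have "Va \<noteq> Vb" "Va \<noteq> Vc" "Vb \<noteq> Vc"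
      using abc Va Vb Vc by blast+
    moreover have "card {X \<in> {Va, Vb, Vc}. \<exists>w. w \<in> X \<inter> W} = (\<Sum>X\<in>{Va, Vb, Vc}. ?n X)"
      by (subst sum.inter_filter[symmetric]) auto
    ultimately have "card {X \<in> {Va, Vb, Vc}. \<exists>w. w \<in> X \<inter> W} = ?n Va + ?n Vb + ?n Vc"
      by simp
    then show ?thesis
      using k slack gt[OF st(1) u(2)] gt[OF st(2) u(3)] gt[OF st(3) u(4)] by linarith
  qed
  have e2: "size (edges_between E Vab (V - (Va \<union> Vb \<union> Vab))) \<le> 2"
    by (rule edges_leaving_pairwise_intersection[of V E C1 C2 C3 S a b c])
      (use mg sub abc assms(4,6,8,17,19,21) Va Vb Vab in auto)
  have e2': "size (edges_between E Vac (V - (Va \<union> Vc \<union> Vac))) \<le> 2"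
    by (rule edges_leaving_pairwise_intersection[of V E C1 C3 C2 S a c b])
      (use mg sub abc assms(4,6,8,17,19,21) Va Vc Vac in auto)
  have e2'': "size (edges_between E Vbc (V - (Vb \<union> Vc \<union> Vbc))) \<le> 2"
    by (rule edges_leaving_pairwise_intersection[of V E C2 C3 C1 S b c a])
      (use mg sub abc assms(4,6,8,17,19,21) Vb Vc Vbc in auto)
  define P where "P Vx Vy Vz Vxy Vyz Vxz \<longleftrightarrow>
      (\<exists>F. F \<subseteq># E \<and> size F \<le> 2
            \<and> (\<forall>u \<in> Vxy. \<forall>v. adjacent (E - F) u v \<longrightarrow> v \<in> Vxy \<union> Vx \<union> Vy))
         \<and> V - (Vx \<union> Vy \<union> Vxy) = Vz \<union> Vxz \<union> Vyz \<union> Vabc \<union> VPhi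
         \<and> size (edges_between E Vxy (V - (Vx \<union> Vy \<union> Vxy))) \<le> 2" for Vx Vy Vz Vxy Vyz Vxz
  have P: "P Vx Vy Vz Vxy Vyz Vxz"
    if "size (edges_between E Vxy (V - (Vx \<union> Vy \<union> Vxy))) \<le> 2"
      and "V - (Vx \<union> Vy \<union> Vxy) = Vz \<union> Vxz \<union> Vyz \<union> Vabc \<union> VPhi" for Vx Vy Vz Vxy Vyz Vxz
  proof -
    \<comment> \<open>The witness for the exceptional edges is the very multiset bounded by
      2.\<close>
    let ?F = "edges_between E Vxy (V - (Vx \<union> Vy \<union> Vxy))"
    have "?F \<subseteq># E"
      by (simp add: edges_between_def)
    moreover have "\<forall>u \<in> Vxy. \<forall>v. adjacent (E - ?F) u v \<longrightarrow> v \<in> Vxy \<union> Vx \<union> Vy"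
      using adjacent_after_removing_edges_between[OF mg, of _ Vxy "Vx \<union> Vy \<union> Vxy"] by blast
    ultimately show ?thesis
      unfolding P_def using that by blast
  qed
  \<comment> \<open>Exchanging \<open>x\<close> and \<open>y\<close> reduces the six orderings to
    three.\<close>
  have P_swap: "P Vx Vy Vz Vxy Vyz Vxz \<longleftrightarrow> P Vy Vx Vz Vxy Vxz Vyz" for Vx Vy Vz Vxy Vyz Vxz
    unfolding P_def by (simp only: Un_ac)
  have "P Va Vb Vc Vab Vbc Vac"
    by (rule P[OF e2]) (unfold Va Vb Vc Vab Vbc Vac assms(15,16), use sub in blast)
  moreover have "P Va Vc Vb Vac Vbc Vab"
    by (rule P[OF e2']) (unfold Va Vb Vc Vab Vbc Vac assms(15,16), use sub in blast)
  moreover have "P Vb Vc Va Vbc Vac Vab"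
    by (rule P[OF e2'']) (unfold Va Vb Vc Vab Vbc Vac assms(15,16), use sub in blast)
  ultimately have all: "\<forall>(Vx, Vy, Vz, Vxy, Vyz, Vxz) \<in>
         {(Va, Vb, Vc, Vab, Vbc, Vac), (Va, Vc, Vb, Vac, Vbc, Vab),
          (Vb, Va, Vc, Vab, Vac, Vbc), (Vb, Vc, Va, Vbc, Vac, Vab),
          (Vc, Va, Vb, Vac, Vab, Vbc), (Vc, Vb, Va, Vbc, Vab, Vac)}. P Vx Vy Vz Vxy Vyz Vxz"
    by (simp add: P_swap)
  fix p
  assume p: "p \<in> {(Va, Vb, Vc, Vab, Vbc, Vac), (Va, Vc, Vb, Vac, Vbc, Vab),
          (Vb, Va, Vc, Vab, Vac, Vbc), (Vb, Vc, Va, Vbc, Vac, Vab),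
          (Vc, Va, Vb, Vac, Vab, Vbc), (Vc, Vb, Va, Vbc, Vab, Vac)}"
  show "case p of (Vx, Vy, Vz, Vxy, Vyz, Vxz) \<Rightarrow>
      (\<exists>F. F \<subseteq># E \<and> size F \<le> 2
            \<and> (\<forall>u \<in> Vxy. \<forall>v. adjacent (E - F) u v \<longrightarrow> v \<in> Vxy \<union> Vx \<union> Vy))
         \<and> V - (Vx \<union> Vy \<union> Vxy) = Vz \<union> Vxz \<union> Vyz \<union> Vabc \<union> VPhi
         \<and> size (edges_between E Vxy (V - (Vx \<union> Vy \<union> Vxy))) \<le> 2"
    using all p unfolding P_def by (rule bspec)
qed

end
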